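(* Let $J$ be an arbitrary index set, let $(e_j)_{j\in J}$ be distinct transmission lines in $E$ and let $\tilde\tau_j\in(0,\bar\tau]$ for $j\in J$. For each $j\in J$ let $S^*_{\alpha,j}\in\mathcal{S}^*_\alpha(e_j,\tilde\tau_j)$ be a Correlation Index, and suppose $\bigcap_{j\in J}S^*_{\alpha,j}\neq\emptyset$. Suppose the measurements at a substation $s_k^*\in\bigcap_{j\in J}S^*_{\alpha,j}$ are protected. Then for every $j\in J$ one of the following occurs: (i) $S^*_{\alpha,j}$ is the unique Correlation Index for $(e_j,\tilde\tau_j)$ before protection, and after $s_k^*$ is protected every new Correlation Index $S^*_{\beta,j}\in\mathcal{S}^*_\beta(e_j,\tilde\tau_j)$ (such an index exists but is not necessarily unique) requires targeting more substations: $\kappa^*_\beta:=|S^*_{\beta,j}|>|S^*_{\alpha,j}|$. (ii) $S^*_{\alpha,j}$ is not the only Correlation Index for $(e_j,\tilde\tau_j)$ before protection, and either (a) $s_k^*$ belongs to every $T\in\mathcal{S}^*_\alpha(e_j,\tilde\tau_j)$, and after protection new Correlation Indices $S^*_{\beta,j}\in\mathcal{S}^*_\beta(e_j,\tilde\tau_j)$ exist and all satisfy $\kappa^*_\beta=|S^*_{\beta,j}|>|S^*_{\alpha,j}|$; or (b) $\{s_k^*\}\cap T=\emptyset$ for some $T\in\mathcal{S}^*_\alpha(e_j,\tilde\tau_j)$, and the new collection of Correlation Indices satisfies $\mathcal{S}^*_\beta(e_j,\tilde\tau_j)\subset\mathcal{S}^*_\alpha(e_j,\tilde\tau_j)$.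 (iii) After protection the attack is infeasible, i.e. there is no effective attack for $(e_j,\tilde\tau_j)$ and hence no Correlation Index in $\mathcal{S}^*_\beta(e_j,\tilde\tau_j)$.
   Context: Power grid: a finite graph $G=(V,E)$ with $n=|V|$ buses and $m=|E|$ transmission lines, and a finite set of substations $S=\{s_1,\dots,s_{n_s}\}$. Substation $s_k$ has a service area, a subgraph $G_{s_k}=(V_{s_k},E_{s_k})$ of $G$, with $\bigcup_k G_{s_k}=G$; service areas may overlap, but the overlaps contain no buses with generation. Given data: demand $P_d\in\mathbb{R}_{\ge0}^n$, generation limits $\bar P_g\in\mathbb{R}_{\ge0}^n$, line capacities $\bar P_f\in\mathbb{R}_{\ge0}^m$, a generator shift matrix $F\in\mathbb{R}^{m\times n}$ (with row $[F]_e$ for $e\in E$), cost data $c_2,c_1\in\mathbb{R}^n_{\ge0}$, $c_0\in\mathbb{R}$, $C_2=\mathrm{diag}(c_2)$, an attack bound $\bar a>0$, and $\bar\tau>0$. Security Constrained Economic Dispatch (SCED) under an attack signal $a\in\mathbb{R}^n$: minimize $\frac12P_g^\top C_2P_g+c_1^\top P_g+c_0$ over $P_g\in\mathbb{R}^n$ subject to $\mathbf 1^\top P_g=\mathbf 1^\top(P_d+a)$, $\mathbf 0\preceq P_g\preceq\bar P_g$ and $-\bar P_f\preceq F(P_g-P_d-a)\preceq\bar P_f$ (entrywise inequalities). The objective is assumed strictly convex in $P_g$. $P_g^*(a)$ denotes the optimal solution when the problem is feasible; the problem is assumed feasible for $a=0$. The flow on line $e$ before the attack is $P_{f,e}(0)=[F]_e(P_g^*(0)-P_d)$.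 A coordinated cyber-attack (CCA) is identified with the set $T\in2^S$ of its target substations. Put $\delta_{s_k}=1$ if $s_k\in T$ and $\delta_{s_k}=0$ otherwise. An attack signal $a\in\mathbb{R}^n$ is admissible for $T$ if $a_i\in\delta_{s_k}[-\bar a,\bar a]$ for all $s_k\in S$ and all $i\in V_{s_k}$. The CCA $T$ is effective for the attack goal $(e,\tilde\tau)$ (with $e\in E$, $\tilde\tau\in(0,\bar\tau]$), written $T\to(e,\tilde\tau)$, if there is an admissible $a$ for $T$ such that SCED under $a$ is feasible and $[F]_e(P_g^*(a)-P_d)\ge(1+\tilde\tau)P_{f,e}(0)$ if $P_{f,e}(0)\ge0$, respectively $[F]_e(P_g^*(a)-P_d)\le(1+\tilde\tau)P_{f,e}(0)$ if $P_{f,e}(0)<0$. The set of effective CCAs is $\mathcal{S}_\alpha(e,\tilde\tau)=\{T\in2^S: T\to(e,\tilde\tau)\}$. The security index $\kappa^*$ for $(e,\tilde\tau)$ is the least number of target substations of an effective CCA, $\kappa^*=\min\{|T|:T\in\mathcal{S}_\alpha(e,\tilde\tau)\}$. A Correlation Index (CI) for $(e,\tilde\tau)$ is an effective CCA with exactly $\kappa^*$ target substations; $\mathcal{S}^*_\alpha(e,\tilde\tau)\subseteq\mathcal{S}_\alpha(e,\tilde\tau)$ is the set of all CIs. Protection: protecting the measurements at substation $s_k^*$ means the adversary cannot corrupt measurements there, i.e. the constraint $\delta_{s_k^*}=0$ is imposed, so that the CCAs effective for $(e,\tilde\tau)$ after protection are exactly the $T\in\mathcal{S}_\alpha(e,\tilde\tau)$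 with $s_k^*\notin T$. The attack is infeasible after protection if there are none. Otherwise, the new security index $\kappa^*_\beta$ is the minimum cardinality of such $T$, and the collection $\mathcal{S}^*_\beta(e,\tilde\tau)$ of new CIs consists of all such $T$ with $|T|=\kappa^*_\beta$. Convention: $\subset$ denotes proper inclusion, $\subseteq$ inclusion. *)

theory Defs
  imports "HOL-Analysis.Analysis"
begin

text \<open>
  Buses, transmission lines and substations are the elements of finite types \<open>'v\<close>, \<open>'e\<close> and \<open>'s\<close>,
  so \<open>V\<close>, \<open>E\<close> and \<open>S\<close> are \<open>UNIV\<close>, and \<open>n\<close>, \<open>m\<close> and the number of substations are the
  (arbitrary, positive) cardinalities of these types. A line is an abstract edge with a set of two
  end buses; parallel lines are allowed.
\<close>

record ('v::finite, 'e::finite, 's) power_grid =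
  line_ends :: "'e \<Rightarrow> 'v set"
  area_buses :: "'s \<Rightarrow> 'v set"
  area_lines :: "'s \<Rightarrow> 'e set"
  demand :: "real ^ 'v"
  gen_limit :: "real ^ 'v"
  line_capacity :: "real ^ 'e"
  shift_matrix :: "real ^ 'v ^ 'e"
  cost_quad :: "real ^ 'v"
  cost_lin :: "real ^ 'v"
  cost_const :: real
  attack_bound :: real
  tau_max :: real

definition diag_matrix :: "real ^ 'v \<Rightarrow> real ^ 'v ^ 'v" where
  "diag_matrix c = (\<chi> i j. if i = j then c $ i else 0)"

definition strictly_convex_on :: "'a::real_vector set \<Rightarrow> ('a \<Rightarrow> real) \<Rightarrow> bool" where
  "strictly_convex_on A f \<longleftrightarrow> convex A \<and>
     (\<forall>x\<in>A. \<forall>y\<in>A. x \<noteq> y \<longrightarrow>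
        (\<forall>t\<in>{0<..<1}. f ((1 - t) *\<^sub>R x + t *\<^sub>R y) < (1 - t) * f x + t * f y))"

definition sced_cost :: "('v::finite, 'e::finite, 's) power_grid \<Rightarrow> real ^ 'v \<Rightarrow> real" where
  "sced_cost G Pg =
     1 / 2 * (Pg \<bullet> (diag_matrix (cost_quad G) *v Pg)) + cost_lin G \<bullet> Pg + cost_const G"

text \<open>The order on vectors is the entrywise one, and the vector \<open>1\<close> has all entries 1.\<close>

definition sced_feasible ::
    "('v::finite, 'e::finite, 's) power_grid \<Rightarrow> real ^ 'v \<Rightarrow> (real ^ 'v) set" where
  "sced_feasible G a = {Pg.
     1 \<bullet> Pg = 1 \<bullet> (demand G + a) \<and>
     0 \<le> Pg \<and> Pg \<le> gen_limit G \<and>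
     - line_capacity G \<le> shift_matrix G *v (Pg - demand G - a) \<and>
     shift_matrix G *v (Pg - demand G - a) \<le> line_capacity G}"

text \<open>
  For a valid grid with nonempty \<open>sced_feasible G a\<close> the minimizer exists (compactness) and is
  unique (strict convexity); otherwise the value is unspecified and not used.
\<close>

definition optimal_dispatch ::
    "('v::finite, 'e::finite, 's) power_grid \<Rightarrow> real ^ 'v \<Rightarrow> real ^ 'v" where
  "optimal_dispatch G a = (THE Pg. is_arg_min (sced_cost G) (\<lambda>P. P \<in> sced_feasible G a) Pg)"

text \<open>
  A bus counts as a bus with generation iff its generation limit is positive.
\<close>

definition valid_grid :: "('v::finite, 'e::finite, 's::finite) power_grid \<Rightarrow> bool" where
  "valid_grid G \<longleftrightarrow>
     (\<forall>l. card (line_ends G l) = 2) \<and>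
     (\<forall>s. \<forall>l\<in>area_lines G s. line_ends G l \<subseteq> area_buses G s) \<and>
     (\<Union>s. area_buses G s) = UNIV \<and> (\<Union>s. area_lines G s) = UNIV \<and>
     (\<forall>s s'. s \<noteq> s' \<longrightarrow>
        (\<forall>i \<in> area_buses G s \<inter> area_buses G s'. \<not> gen_limit G $ i > 0)) \<and>
     0 \<le> demand G \<and> 0 \<le> gen_limit G \<and> 0 \<le> line_capacity G \<and>
     0 \<le> cost_quad G \<and> 0 \<le> cost_lin G \<and>
     0 < attack_bound G \<and> 0 < tau_max G \<and>
     strictly_convex_on UNIV (sced_cost G) \<and>
     sced_feasible G 0 \<noteq> {}"

text \<open>
  The flow is evaluated at the true demand: the attack \<open>a\<close> enters only through the dispatch.
\<close>

definition line_flow ::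
    "('v::finite, 'e::finite, 's) power_grid \<Rightarrow> 'e \<Rightarrow> real ^ 'v \<Rightarrow> real" where
  "line_flow G l a = row l (shift_matrix G) \<bullet> (optimal_dispatch G a - demand G)"

definition target_indicator :: "'s set \<Rightarrow> 's \<Rightarrow> real" where
  "target_indicator T s = (if s \<in> T then 1 else 0)"

definition admissible_attack ::
    "('v::finite, 'e::finite, 's) power_grid \<Rightarrow> 's set \<Rightarrow> real ^ 'v \<Rightarrow> bool" where
  "admissible_attack G T a \<longleftrightarrow>
     (\<forall>s. \<forall>i \<in> area_buses G s.
        a $ i \<in> (\<lambda>x. target_indicator T s * x) ` {- attack_bound G .. attack_bound G})"

definition effective_CCA ::
    "('v::finite, 'e::finite, 's) power_grid \<Rightarrow> 'e \<Rightarrow> real \<Rightarrow> 's set \<Rightarrow> bool" where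
  "effective_CCA G l \<tau> T \<longleftrightarrow>
     (\<exists>a. admissible_attack G T a \<and> sced_feasible G a \<noteq> {} \<and>
        (if line_flow G l 0 \<ge> 0 then line_flow G l a \<ge> (1 + \<tau>) * line_flow G l 0
         else line_flow G l a \<le> (1 + \<tau>) * line_flow G l 0))"

definition effective_CCAs ::
    "('v::finite, 'e::finite, 's) power_grid \<Rightarrow> 'e \<Rightarrow> real \<Rightarrow> 's set set" where
  "effective_CCAs G l \<tau> = {T. effective_CCA G l \<tau> T}"

definition effective_CCAs_protected ::
    "('v::finite, 'e::finite, 's) power_grid \<Rightarrow> 's \<Rightarrow> 'e \<Rightarrow> real \<Rightarrow> 's set set" where
  "effective_CCAs_protected G s l \<tau> = {T \<in> effective_CCAs G l \<tau>. s \<notin> T}"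

text \<open>
  Security index and Correlation Indices of a collection of effective CCAs, used both before and
  after protection. The index of the empty collection is unspecified, but that collection has no
  Correlation Indices.
\<close>

definition security_index :: "'s set set \<Rightarrow> nat" where
  "security_index \<T> = Min (card ` \<T>)"

definition correlation_indices :: "'s set set \<Rightarrow> 's set set" where
  "correlation_indices \<T> = {T \<in> \<T>. card T = security_index \<T>}"

abbreviation CIs_before ::
    "('v::finite, 'e::finite, 's) power_grid \<Rightarrow> 'e \<Rightarrow> real \<Rightarrow> 's set set" where
  "CIs_before G l \<tau> \<equiv> correlation_indices (effective_CCAs G l \<tau>)"

abbreviation CIs_after ::
    "('v::finite, 'e::finite, 's) power_grid \<Rightarrow> 's \<Rightarrow> 'e \<Rightarrow> real \<Rightarrow> 's set set" where
  "CIs_after G s l \<tau> \<equiv> correlation_indices (effective_CCAs_protected G s l \<tau>)"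

abbreviation index_after ::
    "('v::finite, 'e::finite, 's) power_grid \<Rightarrow> 's \<Rightarrow> 'e \<Rightarrow> real \<Rightarrow> nat" where
  "index_after G s l \<tau> \<equiv> security_index (effective_CCAs_protected G s l \<tau>)"

end

theory Submission
  imports Defs
begin

text \<open>For each \<open>j\<close> the claim compares the smallest members of a family of finite
  sets, the effective CCAs, with the smallest members of its subfamily avoiding \<open>s\<close>. If
  the subfamily is nonempty, its least cardinality is at least the old one. Equality holds exactly
  when some old minimizer avoids \<open>s\<close>; the new minimizers are then old ones, and
  \<open>CI j\<close>, which contains \<open>s\<close>, drops out. Otherwise the minimum strictly
  increases. \<open>correlation_indices_avoiding_cases\<close> is this trichotomy; the two lemmas
  before it trade \<open>Min\<close> for comparisons of cardinalities and give existence of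
  minimizers.\<close>

lemma correlation_indices_iff:
  fixes \<T> :: "'s::finite set set"
  shows "T \<in> correlation_indices \<T> \<longleftrightarrow> T \<in> \<T> \<and> (\<forall>U\<in>\<T>. card T \<le> card U)"
proof
  assume "T \<in> correlation_indices \<T>"
  then show "T \<in> \<T> \<and> (\<forall>U\<in>\<T>. card T \<le> card U)"
    by (auto simp: correlation_indices_def security_index_def intro: Min_le)
next
  assume T: "T \<in> \<T> \<and> (\<forall>U\<in>\<T>. card T \<le> card U)"
  then have "security_index \<T> = card T"
    unfolding security_index_def by (intro Min_eqI) auto
  with T show "T \<in> correlation_indices \<T>"
    by (simp add: correlation_indices_def)
qed

lemma correlation_indices_eq_empty_iff:
  fixes \<T> :: "'s::finite set set"
  shows "correlation_indices \<T> = {} \<longleftrightarrow> \<T> = {}"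
proof
  assume "correlation_indices \<T> = {}"
  moreover have "security_index \<T> \<in> card ` \<T>" if "\<T> \<noteq> {}"
    unfolding security_index_def using that by (intro Min_in) auto
  ultimately show "\<T> = {}"
    by (fastforce simp: correlation_indices_def)
qed (simp add: correlation_indices_def)

lemma correlation_indices_avoiding_cases:
  fixes \<T> :: "'s::finite set set" and s :: 's
  defines "\<U> \<equiv> {T \<in> \<T>. s \<notin> T}"
  assumes C: "C \<in> correlation_indices \<T>" and s: "s \<in> C"
  obtains (empty) "\<U> = {}"
  | (increase) "\<forall>T\<in>correlation_indices \<T>. s \<in> T" "correlation_indices \<U> \<noteq> {}"
      "\<forall>T\<in>correlation_indices \<U>. security_index \<U> = card T \<and> card T > card C"
  | (shrink) "\<exists>T\<in>correlation_indices \<T>. s \<notin> T"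
      "correlation_indices \<U> \<subset> correlation_indices \<T>"
proof (cases "\<U> = {}")
  case True
  then show thesis by (rule empty)
next
  case False
  show thesis
  proof (cases "\<forall>T\<in>correlation_indices \<T>. s \<in> T")
    case all: True
    \<comment> \<open>A surviving \<open>T\<close> no larger than \<open>C\<close> would be a
      minimizer of the whole family, hence would contain \<open>s\<close>.\<close>
    have "card C < card T" if "T \<in> correlation_indices \<U>" for T
    proof (rule ccontr)
      assume "\<not> card C < card T"
      with that C have "T \<in> correlation_indices \<T>"
        unfolding correlation_indices_iff \<U>_def by fastforce
      with all that show False
        by (auto simp: correlation_indices_iff \<U>_def)
    qed
    moreover have "security_index \<U> = card T" if "T \<in> correlation_indices \<U>" for T
      using that by (simp add: correlation_indices_def)
    ultimately show thesis
      using all False by (intro increase) (auto simp: correlation_indices_eq_empty_iff)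
  next
    case False
    then obtain B where B: "B \<in> correlation_indices \<T>" "s \<notin> B" by blast
    \<comment> \<open>\<open>B\<close> survives in \<open>\<U>\<close>, so the minimum does not
      rise.\<close>
    have "correlation_indices \<U> \<subseteq> correlation_indices \<T>"
    proof
      fix T assume T: "T \<in> correlation_indices \<U>"
      with B have "card T \<le> card B" "T \<in> \<T>"
        by (auto simp: correlation_indices_iff \<U>_def)
      with B show "T \<in> correlation_indices \<T>"
        by (auto simp: correlation_indices_iff intro: order_trans)
    qed
    \<comment> \<open>This makes the inclusion proper.\<close>
    moreover have "C \<notin> correlation_indices \<U>"
      using s by (simp add: correlation_indices_iff \<U>_def)
    ultimately show thesis
      using B C by (intro shrink) auto
  qed
qed

theorem theorem2:
  fixes G :: "('v::finite, 'e::finite, 's::finite) power_grid"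
    and J :: "'j set" and l :: "'j \<Rightarrow> 'e" and \<tau> :: "'j \<Rightarrow> real"
    and CI :: "'j \<Rightarrow> 's set" and s :: 's
  assumes "valid_grid G"
    and "inj_on l J"
    and "\<And>j. j \<in> J \<Longrightarrow> \<tau> j \<in> {0 <.. tau_max G}"
    and "\<And>j. j \<in> J \<Longrightarrow> CI j \<in> CIs_before G (l j) (\<tau> j)"
    and "(\<Inter>j\<in>J. CI j) \<noteq> {}"
    and "s \<in> (\<Inter>j\<in>J. CI j)"
  shows "\<forall>j\<in>J.
    (CIs_before G (l j) (\<tau> j) = {CI j} \<and>
      CIs_after G s (l j) (\<tau> j) \<noteq> {} \<and>
      (\<forall>T \<in> CIs_after G s (l j) (\<tau> j).
         index_after G s (l j) (\<tau> j) = card T \<and> card T > card (CI j)))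
    \<or>
    (CIs_before G (l j) (\<tau> j) \<noteq> {CI j} \<and>
      (((\<forall>T \<in> CIs_before G (l j) (\<tau> j). s \<in> T) \<and>
        CIs_after G s (l j) (\<tau> j) \<noteq> {} \<and>
        (\<forall>T \<in> CIs_after G s (l j) (\<tau> j).
           index_after G s (l j) (\<tau> j) = card T \<and> card T > card (CI j)))
       \<or>
       ((\<exists>T \<in> CIs_before G (l j) (\<tau> j). {s} \<inter> T = {}) \<and>
        CIs_after G s (l j) (\<tau> j) \<subset> CIs_before G (l j) (\<tau> j))))
    \<or>
    (effective_CCAs_protected G s (l j) (\<tau> j) = {} \<and>
      CIs_after G s (l j) (\<tau> j) = {})"
proof (rule ballI, goal_cases)
  case (1 j)
  with assms have C: "CI j \<in> CIs_before G (l j) (\<tau> j)" and s: "s \<in> CI j"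
    by blast+
  from C s show ?case
  proof (cases rule: correlation_indices_avoiding_cases)
    case empty
    then show ?thesis
      by (simp add: effective_CCAs_protected_def correlation_indices_eq_empty_iff)
  next
    \<comment> \<open>This covers both (i) and (ii)(a), according to whether \<open>CI j\<close> is
      the only Correlation Index.\<close>
    case increase
    then show ?thesis
      unfolding effective_CCAs_protected_def by blast
  next
    \<comment> \<open>The Correlation Index avoiding \<open>s\<close> differs from
      \<open>CI j\<close>, which contains \<open>s\<close>; so uniqueness fails and (ii)(b)
      holds.\<close>
    case shrink
    with s show ?thesis
      unfolding effective_CCAs_protected_def by blast
  qed
qed

end
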